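(* Let $A$ be a commutative pseudo-BCI algebra and define $d_{\varphi}:A\to A$ by $d_{\varphi}(x)=\varphi_x=(x\to 1)\rightsquigarrow 1$ for all $x\in A$. Then $d_{\varphi}$ is both a type I and a type II implicative derivation on $A$, i.e. $d_{\varphi}\in \mathcal{IDOP}(A)$.
   Context: A pseudo-BCI algebra is a structure $(A,\to,\rightsquigarrow,1)$ of type $(2,2,0)$ such that for all $x,y,z\in A$: $(x\to y)\rightsquigarrow[(y\to z)\rightsquigarrow(x\to z)]=1$; $(x\rightsquigarrow y)\to[(y\rightsquigarrow z)\to(x\rightsquigarrow z)]=1$; $1\to x=x$; $1\rightsquigarrow x=x$; and $x\to y=1$, $y\to x=1$ imply $x=y$. Write $x\le y$ iff $x\to y=1$ (equivalently $x\rightsquigarrow y=1$). Put $x\Cup_1 y=(x\to y)\rightsquigarrow y$ and $x\Cup_2 y=(x\rightsquigarrow y)\to y$. $A$ is called commutative if $x\Cup_1 y=x\Cup_2 y=x$ whenever $y\le x$. A map $d:A\to A$ is a type I implicative derivation if $d(x\to y)=(x\to d(y))\Cup_2(d(x)\to y)$ and $d(x\rightsquigarrow y)=(x\rightsquigarrow d(y))\Cup_1(d(x)\rightsquigarrow y)$ for all $x,y$; it is a type II implicative derivation if $d(x\to y)=(d(x)\to y)\Cup_2(x\to d(y))$ and $d(x\rightsquigarrow y)=(d(x)\rightsquigarrow y)\Cup_1(x\rightsquigarrow d(y))$ for all $x,y$. $\mathcal{IDOP}(A)$ denotes the set of maps that are both type I and type II implicative derivations. *)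

theory Defs
  imports Main "HOL-Library.FuncSet"
begin

locale pseudo_BCI =
  fixes A :: "'a set"
    and imp :: "'a \<Rightarrow> 'a \<Rightarrow> 'a"  (infixr "\<^bold>\<rightarrow>" 65)
    and wimp :: "'a \<Rightarrow> 'a \<Rightarrow> 'a"  (infixr "\<leadsto>" 65)
    and one :: 'a  ("\<one>")
  assumes imp_closed: "x \<in> A \<Longrightarrow> y \<in> A \<Longrightarrow> x \<^bold>\<rightarrow> y \<in> A"
    and wimp_closed: "x \<in> A \<Longrightarrow> y \<in> A \<Longrightarrow> x \<leadsto> y \<in> A"
    and one_closed: "\<one> \<in> A"
    and imp_trans: "x \<in> A \<Longrightarrow> y \<in> A \<Longrightarrow> z \<in> A \<Longrightarrow>
      (x \<^bold>\<rightarrow> y) \<leadsto> ((y \<^bold>\<rightarrow> z) \<leadsto> (x \<^bold>\<rightarrow> z)) = \<one>"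
    and wimp_trans: "x \<in> A \<Longrightarrow> y \<in> A \<Longrightarrow> z \<in> A \<Longrightarrow>
      (x \<leadsto> y) \<^bold>\<rightarrow> ((y \<leadsto> z) \<^bold>\<rightarrow> (x \<leadsto> z)) = \<one>"
    and one_imp: "x \<in> A \<Longrightarrow> \<one> \<^bold>\<rightarrow> x = x"
    and one_wimp: "x \<in> A \<Longrightarrow> \<one> \<leadsto> x = x"
    and imp_antisym: "x \<in> A \<Longrightarrow> y \<in> A \<Longrightarrow> x \<^bold>\<rightarrow> y = \<one> \<Longrightarrow> y \<^bold>\<rightarrow> x = \<one> \<Longrightarrow> x = y"
begin

definition le :: "'a \<Rightarrow> 'a \<Rightarrow> bool"  (infix "\<preceq>" 50)
  where "x \<preceq> y \<longleftrightarrow> x \<^bold>\<rightarrow> y = \<one>"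

definition cup1 :: "'a \<Rightarrow> 'a \<Rightarrow> 'a"  (infixl "\<squnion>\<^sub>1" 60)
  where "x \<squnion>\<^sub>1 y = (x \<^bold>\<rightarrow> y) \<leadsto> y"

definition cup2 :: "'a \<Rightarrow> 'a \<Rightarrow> 'a"  (infixl "\<squnion>\<^sub>2" 60)
  where "x \<squnion>\<^sub>2 y = (x \<leadsto> y) \<^bold>\<rightarrow> y"

text \<open>Self-maps of the algebra are taken in \<open>A \<rightarrow>\<^sub>E A\<close>, so that each map on \<open>A\<close> is
  represented by exactly one HOL function.\<close>

definition typeI_implicative_derivation :: "('a \<Rightarrow> 'a) \<Rightarrow> bool"
  where "typeI_implicative_derivation d \<longleftrightarrow>
    d \<in> A \<rightarrow>\<^sub>E A \<and>
    (\<forall>x\<in>A. \<forall>y\<in>A.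
      d (x \<^bold>\<rightarrow> y) = (x \<^bold>\<rightarrow> d y) \<squnion>\<^sub>2 (d x \<^bold>\<rightarrow> y) \<and>
      d (x \<leadsto> y) = (x \<leadsto> d y) \<squnion>\<^sub>1 (d x \<leadsto> y))"

definition typeII_implicative_derivation :: "('a \<Rightarrow> 'a) \<Rightarrow> bool"
  where "typeII_implicative_derivation d \<longleftrightarrow>
    d \<in> A \<rightarrow>\<^sub>E A \<and>
    (\<forall>x\<in>A. \<forall>y\<in>A.
      d (x \<^bold>\<rightarrow> y) = (d x \<^bold>\<rightarrow> y) \<squnion>\<^sub>2 (x \<^bold>\<rightarrow> d y) \<and>
      d (x \<leadsto> y) = (d x \<leadsto> y) \<squnion>\<^sub>1 (x \<leadsto> d y))"

definition IDOP :: "('a \<Rightarrow> 'a) set"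
  where "IDOP = {d. typeI_implicative_derivation d \<and> typeII_implicative_derivation d}"

definition d_phi :: "'a \<Rightarrow> 'a"
  where "d_phi = (\<lambda>x\<in>A. (x \<^bold>\<rightarrow> \<one>) \<leadsto> \<one>)"

end

locale commutative_pseudo_BCI = pseudo_BCI +
  assumes commutative: "x \<in> A \<Longrightarrow> y \<in> A \<Longrightarrow> y \<preceq> x \<Longrightarrow> x \<squnion>\<^sub>1 y = x \<and> x \<squnion>\<^sub>2 y = x"

end

theory Submission
  imports Defs
begin

text \<open>Write \<open>\<phi>\<close> for \<open>d_phi\<close>. Both \<open>x \<^bold>\<rightarrow> \<phi> y\<close> and \<open>\<phi> (x \<^bold>\<rightarrow> y)\<close> equal \<open>(y \<^bold>\<rightarrow> \<one>) \<leadsto> (x \<^bold>\<rightarrow> \<one>)\<close>,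
  and \<open>\<phi> x \<^bold>\<rightarrow> y\<close> lies below this element \<open>a\<close>. For \<open>b \<preceq> a\<close> commutativity gives \<open>a \<squnion>\<^sub>2 b = a\<close>
  (type I), while \<open>b \<squnion>\<^sub>2 a = a\<close> holds in every pseudo-BCI algebra (type II). The identities for
  \<open>\<leadsto>\<close> follow by exchanging the two implications, which leaves \<open>\<phi>\<close> unchanged because
  \<open>x \<^bold>\<rightarrow> \<one> = x \<leadsto> \<one>\<close>.\<close>

context pseudo_BCI
begin

lemmas closed = imp_closed wimp_closed one_closed

text \<open>At \<open>\<one>\<close>, \<open>\<one>\<close>, \<open>x\<close> the unit laws strip
  \<open>wimp_trans\<close> down to reflexivity.\<close>

lemma imp_refl: "x \<in> A \<Longrightarrow> x \<^bold>\<rightarrow> x = \<one>"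
  using wimp_trans[of \<one> \<one> x] by (simp add: closed one_imp one_wimp)

lemma wimp_refl: "x \<in> A \<Longrightarrow> x \<leadsto> x = \<one>"
  using imp_trans[of \<one> \<one> x] by (simp add: closed one_imp one_wimp)

lemma wimp_cup1: "x \<in> A \<Longrightarrow> y \<in> A \<Longrightarrow> x \<leadsto> (x \<^bold>\<rightarrow> y) \<leadsto> y = \<one>"
  using imp_trans[of \<one> x y] by (simp add: closed one_imp)

lemma imp_cup2: "x \<in> A \<Longrightarrow> y \<in> A \<Longrightarrow> x \<^bold>\<rightarrow> (x \<leadsto> y) \<^bold>\<rightarrow> y = \<one>"
  using wimp_trans[of \<one> x y] by (simp add: closed one_wimp)

text \<open>When one implication equals \<open>\<one>\<close>, the unit law reduces
  \<open>wimp_cup1\<close> or \<open>imp_cup2\<close> to the other one.\<close>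

lemma imp_eq_one_iff: "x \<in> A \<Longrightarrow> y \<in> A \<Longrightarrow> x \<^bold>\<rightarrow> y = \<one> \<longleftrightarrow> x \<leadsto> y = \<one>"
  using wimp_cup1[of x y] imp_cup2[of x y] by (metis one_imp one_wimp)

text \<open>Only antisymmetry is not literally symmetric in the two implications;
  \<open>imp_eq_one_iff\<close> transfers it. Every result of the locale thus has a mirror
  image.\<close>

lemma dual: "pseudo_BCI A wimp imp one"
proof
  show "x = y" if "x \<in> A" "y \<in> A" "x \<leadsto> y = \<one>" "y \<leadsto> x = \<one>" for x y
    using that imp_antisym[of x y] imp_eq_one_iff[of x y] imp_eq_one_iff[of y x] by blast
qed (simp_all add: closed imp_trans wimp_trans one_imp one_wimp)

lemma le_trans: "x \<preceq> z"
  if "x \<preceq> y" "y \<preceq> z" "x \<in> A" "y \<in> A" "z \<in> A"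
  using imp_trans[of x y z] that by (simp add: le_def closed one_wimp)

lemma imp_antimono: "y \<^bold>\<rightarrow> z \<preceq> x \<^bold>\<rightarrow> z"
  if "x \<preceq> y" "x \<in> A" "y \<in> A" "z \<in> A"
  using imp_trans[of x y z] that imp_eq_one_iff[of "y \<^bold>\<rightarrow> z" "x \<^bold>\<rightarrow> z"]
  by (simp add: le_def closed one_wimp)

lemma imp_mono: "z \<^bold>\<rightarrow> x \<preceq> z \<^bold>\<rightarrow> y"
  if "x \<preceq> y" "x \<in> A" "y \<in> A" "z \<in> A"
  using imp_trans[of z x y] that imp_eq_one_iff[of "z \<^bold>\<rightarrow> x" "z \<^bold>\<rightarrow> y"]
  by (simp add: le_def closed one_wimp)

lemma wimp_antimono: "y \<leadsto> z \<preceq> x \<leadsto> z"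
  if "x \<preceq> y" "x \<in> A" "y \<in> A" "z \<in> A"
  using wimp_trans[of x y z] that imp_eq_one_iff[of x y] by (simp add: le_def closed one_imp)

lemma le_cup1: "x \<in> A \<Longrightarrow> y \<in> A \<Longrightarrow> x \<preceq> (x \<^bold>\<rightarrow> y) \<leadsto> y"
  by (simp add: le_def closed imp_eq_one_iff wimp_cup1)

lemma le_cup2: "x \<in> A \<Longrightarrow> y \<in> A \<Longrightarrow> x \<preceq> (x \<leadsto> y) \<^bold>\<rightarrow> y"
  by (simp add: le_def imp_cup2)

lemma exchange_le: "x \<^bold>\<rightarrow> (y \<leadsto> z) \<preceq> y \<leadsto> (x \<^bold>\<rightarrow> z)"
  if [simp]: "x \<in> A" "y \<in> A" "z \<in> A"
proof (rule le_trans)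
  \<comment> \<open>Transitivity through \<open>y \<leadsto> z\<close> supplies the middle element;
    replacing its antecedent by the smaller \<open>y\<close> only enlarges it.\<close>
  show "x \<^bold>\<rightarrow> (y \<leadsto> z) \<preceq> ((y \<leadsto> z) \<^bold>\<rightarrow> z) \<leadsto> (x \<^bold>\<rightarrow> z)"
    using imp_trans[of x "y \<leadsto> z" z] by (simp add: le_def closed imp_eq_one_iff)
  show "((y \<leadsto> z) \<^bold>\<rightarrow> z) \<leadsto> (x \<^bold>\<rightarrow> z) \<preceq> y \<leadsto> (x \<^bold>\<rightarrow> z)"
    by (intro wimp_antimono le_cup2) (simp_all add: closed)
qed (simp_all add: closed)

lemma exchange: "x \<^bold>\<rightarrow> (y \<leadsto> z) = y \<leadsto> (x \<^bold>\<rightarrow> z)"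
  if [simp]: "x \<in> A" "y \<in> A" "z \<in> A"
proof (rule imp_antisym)
  show "(x \<^bold>\<rightarrow> (y \<leadsto> z)) \<^bold>\<rightarrow> (y \<leadsto> (x \<^bold>\<rightarrow> z)) = \<one>"
    using exchange_le[of x y z] by (simp add: le_def)
  show "(y \<leadsto> (x \<^bold>\<rightarrow> z)) \<^bold>\<rightarrow> (x \<^bold>\<rightarrow> (y \<leadsto> z)) = \<one>"
    using pseudo_BCI.exchange_le[OF dual, of y x z]
    by (simp add: pseudo_BCI.le_def[OF dual] closed imp_eq_one_iff)
qed (simp_all add: closed)

text \<open>With all three arguments of \<open>exchange\<close> equal, both inner terms become
  \<open>\<one>\<close>.\<close>

lemma imp_one_eq_wimp_one: "x \<in> A \<Longrightarrow> x \<^bold>\<rightarrow> \<one> = x \<leadsto> \<one>"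
  using exchange[of x x x] by (simp add: imp_refl wimp_refl)

text \<open>As for triple negation: antitonicity applied to \<open>le_cup1\<close> gives one
  inequality, \<open>imp_cup2\<close> at \<open>imp x \<one>\<close> the other.\<close>

lemma imp_one_cup1: "((x \<^bold>\<rightarrow> \<one>) \<leadsto> \<one>) \<^bold>\<rightarrow> \<one> = x \<^bold>\<rightarrow> \<one>"
  if [simp]: "x \<in> A"
proof (rule imp_antisym)
  show "(((x \<^bold>\<rightarrow> \<one>) \<leadsto> \<one>) \<^bold>\<rightarrow> \<one>) \<^bold>\<rightarrow> (x \<^bold>\<rightarrow> \<one>) = \<one>"
    using imp_antimono[OF le_cup1[of x \<one>], of \<one>] by (simp add: le_def closed)
  show "(x \<^bold>\<rightarrow> \<one>) \<^bold>\<rightarrow> (((x \<^bold>\<rightarrow> \<one>) \<leadsto> \<one>) \<^bold>\<rightarrow> \<one>) = \<one>"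
    by (simp add: imp_cup2 closed)
qed (simp_all add: closed)

lemma imp_imp_one: "(x \<^bold>\<rightarrow> y) \<^bold>\<rightarrow> \<one> = (x \<^bold>\<rightarrow> \<one>) \<leadsto> (y \<^bold>\<rightarrow> \<one>)"
  if [simp]: "x \<in> A" "y \<in> A"
proof -
  \<comment> \<open>Writing \<open>\<one>\<close> as the self-implication of \<open>imp x y\<close>
    lets \<open>exchange\<close> move \<open>y\<close> inward until it meets the last
    \<open>y\<close>.\<close>
  have "y \<^bold>\<rightarrow> \<one> = y \<leadsto> ((x \<^bold>\<rightarrow> y) \<^bold>\<rightarrow> (x \<^bold>\<rightarrow> y))"
    by (simp add: imp_one_eq_wimp_one imp_refl closed)
  also have "\<dots> = (x \<^bold>\<rightarrow> y) \<^bold>\<rightarrow> (x \<^bold>\<rightarrow> (y \<leadsto> y))"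
    by (simp add: exchange closed)
  finally have "y \<^bold>\<rightarrow> \<one> = (x \<^bold>\<rightarrow> y) \<^bold>\<rightarrow> (x \<^bold>\<rightarrow> \<one>)"
    by (simp add: wimp_refl)
  \<comment> \<open>The same device again: exchanging brings two copies of
    \<open>imp x \<one>\<close> together, and they cancel to \<open>\<one>\<close>.\<close>
  then have "(x \<^bold>\<rightarrow> \<one>) \<leadsto> (y \<^bold>\<rightarrow> \<one>) = (x \<^bold>\<rightarrow> y) \<^bold>\<rightarrow> ((x \<^bold>\<rightarrow> \<one>) \<leadsto> (x \<^bold>\<rightarrow> \<one>))"
    by (simp add: exchange closed)
  then show ?thesis
    by (simp add: wimp_refl closed)
qed

lemma d_phi_eq: "x \<in> A \<Longrightarrow> d_phi x = (x \<^bold>\<rightarrow> \<one>) \<leadsto> \<one>"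
  by (simp add: d_phi_def)

lemma d_phi_closed: "x \<in> A \<Longrightarrow> d_phi x \<in> A"
  by (simp add: d_phi_eq closed)

lemma d_phi_dual: "pseudo_BCI.d_phi A wimp imp one = d_phi"
  unfolding d_phi_def pseudo_BCI.d_phi_def[OF dual]
  by (rule restrict_ext) (simp add: closed flip: imp_one_eq_wimp_one)

lemma le_d_phi: "x \<in> A \<Longrightarrow> x \<preceq> d_phi x"
  by (simp add: d_phi_eq le_cup1 closed)

lemma imp_d_phi: "x \<^bold>\<rightarrow> d_phi y = (y \<^bold>\<rightarrow> \<one>) \<leadsto> (x \<^bold>\<rightarrow> \<one>)"
  if "x \<in> A" "y \<in> A"
  using that by (simp add: d_phi_eq exchange closed)

text \<open>The right side of \<open>imp_d_phi\<close> sees \<open>x\<close> only through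
  \<open>imp x \<one>\<close>, which does not change when \<open>d_phi x\<close> replaces
  \<open>x\<close>.\<close>

lemma d_phi_imp_d_phi: "d_phi x \<^bold>\<rightarrow> d_phi y = x \<^bold>\<rightarrow> d_phi y"
  if "x \<in> A" "y \<in> A"
  using that by (simp add: imp_d_phi d_phi_closed) (simp add: d_phi_eq imp_one_cup1)

lemma d_phi_imp: "d_phi (x \<^bold>\<rightarrow> y) = x \<^bold>\<rightarrow> d_phi y"
  if [simp]: "x \<in> A" "y \<in> A"
proof -
  have "d_phi (x \<^bold>\<rightarrow> y) = ((x \<^bold>\<rightarrow> \<one>) \<leadsto> (y \<^bold>\<rightarrow> \<one>)) \<leadsto> \<one>"
    by (simp add: d_phi_eq imp_imp_one closed)
  \<comment> \<open>The mirror image of \<open>imp_imp_one\<close> produces exactly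
    \<open>d_phi x\<close> and \<open>d_phi y\<close>.\<close>
  also have "\<dots> = ((x \<^bold>\<rightarrow> \<one>) \<leadsto> \<one>) \<^bold>\<rightarrow> ((y \<^bold>\<rightarrow> \<one>) \<leadsto> \<one>)"
    using pseudo_BCI.imp_imp_one[OF dual, of "x \<^bold>\<rightarrow> \<one>" "y \<^bold>\<rightarrow> \<one>"] by (simp add: closed)
  also have "\<dots> = x \<^bold>\<rightarrow> d_phi y"
    by (simp add: d_phi_imp_d_phi flip: d_phi_eq)
  finally show ?thesis .
qed

text \<open>Monotonicity along \<open>y \<preceq> d_phi y\<close> leads to
  \<open>imp (d_phi x) (d_phi y)\<close>, which \<open>d_phi_imp_d_phi\<close> simplifies.\<close>

lemma d_phi_imp_le: "d_phi x \<^bold>\<rightarrow> y \<preceq> x \<^bold>\<rightarrow> d_phi y"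
  if "x \<in> A" "y \<in> A"
  using imp_mono[OF le_d_phi, of y "d_phi x"] that
  by (simp add: d_phi_imp_d_phi d_phi_closed)

lemma cup2_absorb: "x \<squnion>\<^sub>2 y = y"
  if "x \<preceq> y" "x \<in> A" "y \<in> A"
  using that by (simp add: le_def cup2_def imp_eq_one_iff one_imp)

end

context commutative_pseudo_BCI
begin

text \<open>Swapping the implications interchanges \<open>cup1\<close> and \<open>cup2\<close> and
  keeps the order, so commutativity is self-dual.\<close>

lemma commutative_dual: "commutative_pseudo_BCI A wimp imp one"
proof (rule commutative_pseudo_BCI.intro[OF dual], unfold_locales)
  fix x y assume "x \<in> A" "y \<in> A" "pseudo_BCI.le wimp one y x"
  then show "pseudo_BCI.cup1 wimp imp x y = x \<and> pseudo_BCI.cup2 wimp imp x y = x"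
    using commutative[of x y]
    by (simp add: pseudo_BCI.le_def[OF dual] pseudo_BCI.cup1_def[OF dual]
        pseudo_BCI.cup2_def[OF dual] le_def cup1_def cup2_def imp_eq_one_iff)
qed

lemma d_phi_imp_cup2:
  assumes "x \<in> A" "y \<in> A"
  shows "d_phi (x \<^bold>\<rightarrow> y) = (x \<^bold>\<rightarrow> d_phi y) \<squnion>\<^sub>2 (d_phi x \<^bold>\<rightarrow> y)"
    and "d_phi (x \<^bold>\<rightarrow> y) = (d_phi x \<^bold>\<rightarrow> y) \<squnion>\<^sub>2 (x \<^bold>\<rightarrow> d_phi y)"
  using assms commutative[OF _ _ d_phi_imp_le[of x y]] cup2_absorb[OF d_phi_imp_le[of x y]]
  by (simp_all add: d_phi_imp d_phi_closed closed)

lemma d_phi_wimp_cup1: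
  assumes "x \<in> A" "y \<in> A"
  shows "d_phi (x \<leadsto> y) = (x \<leadsto> d_phi y) \<squnion>\<^sub>1 (d_phi x \<leadsto> y)"
    and "d_phi (x \<leadsto> y) = (d_phi x \<leadsto> y) \<squnion>\<^sub>1 (x \<leadsto> d_phi y)"
  using commutative_pseudo_BCI.d_phi_imp_cup2[OF commutative_dual assms]
  by (simp_all add: d_phi_dual pseudo_BCI.cup2_def[OF dual] cup1_def)

lemma d_phi_in_IDOP: "d_phi \<in> IDOP"
proof -
  have "d_phi \<in> A \<rightarrow>\<^sub>E A"
    by (auto simp: d_phi_def closed)
  then show ?thesis
    unfolding IDOP_def typeI_implicative_derivation_def typeII_implicative_derivation_def
    using d_phi_imp_cup2 d_phi_wimp_cup1 by blast
qed

end

theorem theorem3p8: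
  fixes A :: "'a set" and imp wimp :: "'a \<Rightarrow> 'a \<Rightarrow> 'a" and one :: 'a
  assumes "commutative_pseudo_BCI A imp wimp one"
  shows "pseudo_BCI.d_phi A imp wimp one \<in> pseudo_BCI.IDOP A imp wimp"
  using assms by (rule commutative_pseudo_BCI.d_phi_in_IDOP)

end
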